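(* For every integer $n\geq 1$, \[ \sum_{\lambda\in L_n\cap \mathbb{Z}^n} z^{\lambda_n-\lambda_{n-1}} \;=\; \frac{A_{n-1}(z)}{(1-z)^{n}} \] as formal power series in $z$. Equivalently, the integer point transform of $L_n$ satisfies $\sigma_{L_n}(1,\ldots,1,z^{-1},z)=A_{n-1}(z)/(1-z)^n$.
   Context: The lecture hall cone is $L_n:=\{\lambda\in\mathbb{R}^n : 0\le \frac{\lambda_1}{1}\le\frac{\lambda_2}{2}\le\cdots\le\frac{\lambda_n}{n}\}$. For $K\subseteq\mathbb{R}^n$, the integer point transform is $\sigma_K(z_1,\ldots,z_n)=\sum_{m\in K\cap\mathbb{Z}^n} z_1^{m_1}\cdots z_n^{m_n}$. For $\pi\in S_m$, $\mathrm{des}(\pi)=|\{i:1\le i\le m-1,\ \pi_i>\pi_{i+1}\}|$, and the Eulerian polynomial is $A_m(z)=\sum_{\pi\in S_m} z^{\mathrm{des}(\pi)}$ (so $A_0(z)=1$); equivalently $\sum_{t\ge0}(1+t)^m z^t = A_m(z)/(1-z)^{m+1}$. For $n=1$ one uses the convention $\lambda_0:=0$. *)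

theory Defs
  imports
    "HOL-Analysis.Infinite_Sum"
    "HOL-Computational_Algebra.Formal_Laurent_Series"
    "HOL-Computational_Algebra.Polynomial_FPS"
    "HOL-Combinatorics.Permutations"
begin

text \<open>
  Points of \<open>n\<close>-dimensional real space are functions \<open>nat \<Rightarrow> real\<close> with coordinates \<open>1, \<dots>, n\<close>
  that vanish at all other indices. In particular every point has value \<open>0\<close> at index \<open>0\<close>, which
  is the convention needed for \<open>\<lambda> (n - 1)\<close> when \<open>n = 1\<close>.
\<close>

definition real_space :: "nat \<Rightarrow> (nat \<Rightarrow> real) set" where
  "real_space n = {x. \<forall>i. i \<notin> {1..n} \<longrightarrow> x i = 0}"

definition lecture_hall_cone :: "nat \<Rightarrow> (nat \<Rightarrow> real) set" where
  "lecture_hall_cone n = {l \<in> real_space n.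
     0 \<le> l 1 / 1 \<and> (\<forall>i\<in>{1..<n}. l i / real i \<le> l (Suc i) / real (Suc i))}"

text \<open>The integer points of \<open>K\<close>, as integer-valued functions.\<close>

definition integer_points :: "(nat \<Rightarrow> real) set \<Rightarrow> (nat \<Rightarrow> int) set" where
  "integer_points K = {m. (\<lambda>i. real_of_int (m i)) \<in> K}"

definition laurent_monomial :: "nat \<Rightarrow> (nat \<Rightarrow> 'a::field) \<Rightarrow> (nat \<Rightarrow> int) \<Rightarrow> 'a" where
  "laurent_monomial n z m = (\<Prod>i=1..n. z i powi m i)"

text \<open>
  The integer point transform of a subset \<open>K\<close> of \<open>real_space n\<close>, evaluated at
  \<open>(z 1, \<dots>, z n)\<close>. The infinite sum refers to the topology of \<open>'a\<close>; for \<open>'a = 'b fls\<close> this is the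
  topology of formal Laurent series induced by the subdegree. As usual for \<open>infsum\<close>, the
  value is only meaningful if the family of monomials is summable.
\<close>

definition integer_point_transform ::
    "nat \<Rightarrow> (nat \<Rightarrow> real) set \<Rightarrow> (nat \<Rightarrow> 'a::{field, t2_space}) \<Rightarrow> 'a" where
  "integer_point_transform n K z = (\<Sum>\<^sub>\<infinity>m\<in>integer_points K. laurent_monomial n z m)"

definition des :: "nat \<Rightarrow> (nat \<Rightarrow> nat) \<Rightarrow> nat" where
  "des m p = card {i \<in> {1..<m}. p i > p (Suc i)}"

definition eulerian_poly :: "nat \<Rightarrow> 'a::comm_semiring_1 poly" where
  "eulerian_poly m = (\<Sum>p | p permutes {1..m}. monom 1 (des m p))"

text \<open>
  The exponents \<open>\<lambda> n - \<lambda> (n - 1)\<close> are nonnegative on the cone, so nothing is lost when they are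
  converted to natural numbers.
\<close>

lemma integer_points_last_diff_nonneg:
  assumes "m \<in> integer_points (lecture_hall_cone n)" "n \<ge> 1"
  shows "m n - m (n - 1) \<ge> 0"
proof -
  define l where "l = (\<lambda>i. real_of_int (m i))"
  have l: "l \<in> lecture_hall_cone n"
    using assms by (simp add: l_def integer_points_def)
  have nonneg: "0 \<le> l i / real i" if "1 \<le> i" "i \<le> n" for i
    using that
  proof (induction i rule: dec_induct)
    case base
    then show ?case using l by (simp add: lecture_hall_cone_def)
  next
    case (step i)
    have "l i / real i \<le> l (Suc i) / real (Suc i)"
      using l step.hyps step.prems unfolding lecture_hall_cone_def by auto
    with step show ?case by linarith
  qed
  have "l (n - 1) \<le> l n"
  proof (cases "n = 1")
    case True
    have "l 0 = 0" using l by (simp add: lecture_hall_cone_def real_space_def)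
    with True nonneg[of 1] show ?thesis by simp
  next
    case False
    with \<open>n \<ge> 1\<close> obtain k where k: "n = Suc k" "k \<ge> 1" by (cases n) auto
    have "k \<in> {1..<n}" using k by simp
    then have "l k / real k \<le> l n / real n"
      using l k(1) unfolding lecture_hall_cone_def by blast
    then have "l k \<le> l n / real n * real k"
      using k by (simp add: pos_divide_le_eq)
    also have "\<dots> \<le> l n / real n * real n"
      using nonneg[of n] k by (intro mult_left_mono) auto
    finally show ?thesis using k by simp
  qed
  then show ?thesis by (simp add: l_def)
qed

end

theory Submission
  imports Defs
begin

text \<open>
  The coefficient of \<open>z^t\<close> on the left counts the lattice points of the cone with
  \<open>\<lambda>\<^sub>n = \<lambda>\<^bsub>n-1\<^esub> + t\<close>. The last inequality of the cone then reads
  \<open>\<lambda>\<^bsub>n-1\<^esub> \<le> (n - 1) t\<close>, so these points correspond to the points of the cone of dimension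
  \<open>m = n - 1\<close> with last coordinate at most \<open>m t\<close>. More generally, exactly
  \<open>(t + 1)^(m - r) (t + 2)^r\<close> of its points have last coordinate at most \<open>m t + r\<close>, for
  \<open>0 \<le> r \<le> m\<close>. At \<open>r = 0\<close> this gives \<open>(t + 1)^(n - 1)\<close>, and the theorem becomes the generating
  function of the Eulerian polynomials. The latter follows from the recurrence
  \<open>A\<^bsub>m+1\<^esub> = (1 + m z) A\<^sub>m + z (1 - z) A\<^sub>m'\<close>, obtained by inserting the largest letter into a
  permutation.
\<close>

section \<open>Lattice points of the cone, one coordinate at a time\<close>

lemma integer_points_lecture_hall_cone_outside:
  assumes "l \<in> integer_points (lecture_hall_cone n)" "i \<notin> {1..n}"
  shows "l i = 0"
  using assms by (auto simp: integer_points_def lecture_hall_cone_def real_space_def)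

lemma integer_points_lecture_hall_cone_0:
  "integer_points (lecture_hall_cone 0) = {\<lambda>_. 0}"
  by (auto simp: integer_points_def lecture_hall_cone_def real_space_def fun_eq_iff)

lemma integer_points_lecture_hall_cone_1_iff:
  "l \<in> integer_points (lecture_hall_cone 1) \<longleftrightarrow>
     0 \<le> l 1 \<and> l(1 := 0) \<in> integer_points (lecture_hall_cone 0)"
  by (auto simp: integer_points_def lecture_hall_cone_def real_space_def fun_eq_iff)

lemma divide_le_divide_Suc_iff:
  fixes a b :: int
  assumes "n \<ge> 1"
  shows "real_of_int a / real n \<le> real_of_int b / real (Suc n) \<longleftrightarrow> a * int (Suc n) \<le> b * int n"
proof -
  have "real_of_int a / real n \<le> real_of_int b / real (Suc n) \<longleftrightarrow>
      real_of_int a * real (Suc n) \<le> real_of_int b * real n"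
    using assms by (simp add: divide_simps)
  also have "\<dots> \<longleftrightarrow> real_of_int (a * int (Suc n)) \<le> real_of_int (b * int n)"
    by simp
  finally show ?thesis
    by (simp only: of_int_le_iff)
qed

lemma integer_points_lecture_hall_cone_Suc_iff_aux:
  assumes "n \<ge> 1"
  shows "l \<in> integer_points (lecture_hall_cone (Suc n)) \<longleftrightarrow>
    l n * int (Suc n) \<le> l (Suc n) * int n \<and>
    l(Suc n := 0) \<in> integer_points (lecture_hall_cone n)"
proof -
  have "{1..<Suc n} = insert n {1..<n}" "{1..Suc n} = insert (Suc n) {1..n}"
    using assms by auto
  then show ?thesis
    using assms
    by (auto simp: integer_points_def lecture_hall_cone_def real_space_def
        divide_le_divide_Suc_iff simp del: of_nat_Suc)
qed

lemma integer_points_lecture_hall_cone_last_nonneg: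
  assumes "l \<in> integer_points (lecture_hall_cone n)"
  shows "l n \<ge> 0"
  using assms
proof (induction n arbitrary: l)
  case 0
  then show ?case by (simp add: integer_points_lecture_hall_cone_outside)
next
  case (Suc n)
  show ?case
  proof (cases "n = 0")
    case True
    then show ?thesis
      using Suc.prems integer_points_lecture_hall_cone_1_iff by simp
  next
    case False
    then have *: "l n * int (Suc n) \<le> l (Suc n) * int n"
      "l(Suc n := 0) \<in> integer_points (lecture_hall_cone n)"
      using Suc.prems integer_points_lecture_hall_cone_Suc_iff_aux[of n l] by auto
    have "0 \<le> l n" using Suc.IH[OF *(2)] by simp
    then have "0 \<le> l n * int (Suc n)" by simp
    with *(1) have "0 \<le> l (Suc n) * int n" by linarith
    with False show ?thesis by (simp add: zero_le_mult_iff)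
  qed
qed

text \<open>The sign condition makes one formula serve all dimensions: for \<open>n = 0\<close> the
  cross-multiplied inequality collapses to \<open>l 0 \<le> 0\<close>, and only the sign bounds
  \<open>l 1\<close>.\<close>

lemma integer_points_lecture_hall_cone_Suc_iff:
  "l \<in> integer_points (lecture_hall_cone (Suc n)) \<longleftrightarrow>
    0 \<le> l (Suc n) \<and> l n * int (Suc n) \<le> l (Suc n) * int n \<and>
    l(Suc n := 0) \<in> integer_points (lecture_hall_cone n)"
proof (cases "n = 0")
  case True
  have "l 0 = 0" if "l(1 := 0) \<in> integer_points (lecture_hall_cone 0)"
    using integer_points_lecture_hall_cone_outside[OF that, of 0] by simp
  then show ?thesis
    using True integer_points_lecture_hall_cone_1_iff[of l] by auto
next
  case False
  then show ?thesis
    using integer_points_lecture_hall_cone_Suc_iff_aux[of n l]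
      integer_points_lecture_hall_cone_last_nonneg[of l "Suc n"] by auto
qed

section \<open>Counting lattice points\<close>

text \<open>The last coordinate is determined by the one before it, so dropping it loses nothing. A
  constant \<open>k\<close> gives the slices at a fixed height; \<open>k x = x + t\<close> gives the
  slices with a fixed last difference.\<close>

lemma bij_betw_forget_last:
  "bij_betw (\<lambda>l. l(Suc n := 0))
    {l \<in> integer_points (lecture_hall_cone (Suc n)). l (Suc n) = k (l n)}
    {l \<in> integer_points (lecture_hall_cone n).
      0 \<le> k (l n) \<and> l n * int (Suc n) \<le> k (l n) * int n}"
proof (rule bij_betw_byWitness[where f' = "\<lambda>l. l(Suc n := k (l n))"], goal_cases)
  case 1
  then show ?case by (auto simp: fun_eq_iff)
next
  case 2
  then show ?case by (auto simp: fun_eq_iff integer_points_lecture_hall_cone_outside)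
next
  case 3
  then show ?case by (auto simp: integer_points_lecture_hall_cone_Suc_iff)
next
  case 4
  have "l(Suc n := 0) = l" if "l \<in> integer_points (lecture_hall_cone n)" for l
    using that by (auto simp: fun_eq_iff integer_points_lecture_hall_cone_outside)
  then show ?case by (auto simp: integer_points_lecture_hall_cone_Suc_iff)
qed

text \<open>Passing from \<open>r = n\<close> to \<open>r = 0\<close> with \<open>t\<close> increased by one is consistent, which drives
  the induction on the bound.\<close>

lemma lecture_hall_cone_bounded_count:
  assumes "r \<le> n"
  shows "finite {l \<in> integer_points (lecture_hall_cone n). l n \<le> int (n * t + r)} \<and>
    card {l \<in> integer_points (lecture_hall_cone n). l n \<le> int (n * t + r)}
      = (t + 1) ^ (n - r) * (t + 2) ^ r"
  using assms
proof (induction n arbitrary: t r)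
  case 0
  then show ?case
    by (simp add: integer_points_lecture_hall_cone_0 cong: conj_cong)
next
  case (Suc n)
  let ?L = "\<lambda>n. integer_points (lecture_hall_cone n)"
  \<comment> \<open>The count \<open>C\<close> is built up one slice \<open>E\<close> at a time, and
    each slice is a bounded count in dimension \<open>n\<close>.\<close>
  define C where "C k = {l \<in> ?L (Suc n). l (Suc n) \<le> int k}" for k
  define E where "E k = {l \<in> ?L (Suc n). l (Suc n) = int k}" for k
  have C_0: "C 0 = E 0"
    using integer_points_lecture_hall_cone_last_nonneg[of _ "Suc n"] by (auto simp: C_def E_def intro: antisym)
  have C_Suc: "C (Suc k) = C k \<union> E (Suc k)" and disj: "C k \<inter> E (Suc k) = {}" for k
    by (auto simp: C_def E_def)
  have E: "bij_betw (\<lambda>l. l(Suc n := 0)) (E k) {l \<in> ?L n. l n * int (Suc n) \<le> int k * int n}" for k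
    using bij_betw_forget_last[of n "\<lambda>_. int k"] by (simp add: E_def)
  \<comment> \<open>Division with remainder: since \<open>q < n + 1\<close>, the hypothesis says
    that \<open>((n + 1) t + s) n / (n + 1)\<close> has floor \<open>n t + r\<close>, which is the
    bound on the previous coordinate.\<close>
  have E': "finite (E (Suc n * t + s)) \<and>
      card (E (Suc n * t + s)) = (t + 1) ^ (n - r) * (t + 2) ^ r"
    if "s * n = Suc n * r + q" "q \<le> n" "r \<le> n" for t s r q
  proof -
    have "x * int (Suc n) \<le> int (Suc n * t + s) * int n \<longleftrightarrow> x \<le> int (n * t + r)" for x :: int
    proof -
      have "int (Suc n * t + s) * int n = int (Suc n * (n * t) + s * n)"
        by (simp add: algebra_simps)
      also have "\<dots> = int (n * t + r) * int (Suc n) + int q"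
        by (simp only: that(1)) (simp add: algebra_simps)
      finally have *: "int (Suc n * t + s) * int n = int (n * t + r) * int (Suc n) + int q" .
      have "x * int (Suc n) \<le> y * int (Suc n) + int q \<longleftrightarrow> x \<le> y" for y
      proof
        assume "x * int (Suc n) \<le> y * int (Suc n) + int q"
        then have "x * int (Suc n) < (y + 1) * int (Suc n)"
          using that(2) by (simp add: algebra_simps)
        then show "x \<le> y"
          by (simp add: mult_less_cancel_right)
      next
        assume "x \<le> y"
        then have "x * int (Suc n) \<le> y * int (Suc n)"
          by (intro mult_right_mono) auto
        then show "x * int (Suc n) \<le> y * int (Suc n) + int q"
          by (rule order_trans) (simp only: le_add_same_cancel1 of_nat_0_le_iff)
      qed
      then show ?thesis by (simp only: *)
    qed
    then have "bij_betw (\<lambda>l. l(Suc n := 0)) (E (Suc n * t + s)) {l \<in> ?L n. l n \<le> int (n * t + r)}"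
      using E[of "Suc n * t + s"] by simp
    then show ?thesis
      using Suc.IH[OF that(3), of t] by (simp add: bij_betw_finite bij_betw_same_card)
  qed
  have step: "finite (C (Suc n * t + r)) \<and>
      card (C (Suc n * t + r)) = (t + 1) ^ (Suc n - r) * (t + 2) ^ r"
    if "finite (C (Suc n * t)) \<and> card (C (Suc n * t)) = (t + 1) ^ Suc n" "r \<le> Suc n" for t r
    using that(2)
  proof (induction r)
    case 0
    then show ?case using that(1) by simp
  next
    case (Suc r)
    \<comment> \<open>The slice at offset \<open>r + 1\<close> has quotient \<open>r\<close> and
      remainder \<open>n - r\<close>. Adding it turns one factor \<open>t + 1\<close> of the count
      into \<open>t + 2\<close>.\<close>
    have "Suc r * n = Suc n * r + (n - r)" "n - r \<le> n" "r \<le> n"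
      using Suc.prems by (auto simp: algebra_simps)
    note e = E'[OF this, of t]
    have "card (C (Suc n * t + Suc r)) = card (C (Suc n * t + r)) + card (E (Suc n * t + Suc r))"
      using Suc e disj[of "Suc n * t + r"] by (simp only: add_Suc_right C_Suc) (simp add: card_Un_disjoint)
    also have "\<dots> = (t + 1) ^ (Suc n - r) * (t + 2) ^ r + (t + 1) ^ (n - r) * (t + 2) ^ r"
      using Suc e by simp
    also have "\<dots> = (t + 1) ^ (Suc n - Suc r) * (t + 2) ^ Suc r"
      using \<open>r \<le> n\<close> by (simp add: Suc_diff_le algebra_simps)
    finally show ?case
      using Suc e by (simp add: C_Suc)
  qed
  have base: "finite (C (Suc n * t)) \<and> card (C (Suc n * t)) = (t + 1) ^ Suc n" for t
  proof (induction t)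
    case 0
    show ?case using E'[of 0 0 0 0] by (simp add: C_0)
  next
    case (Suc t)
    then show ?case using step[OF Suc, of "Suc n"] by (simp add: algebra_simps)
  qed
  show ?case
    using step[OF base Suc.prems, of t] by (simp only: C_def)
qed

lemma lecture_hall_cone_last_diff_count:
  fixes n t :: nat
  shows "finite {l \<in> integer_points (lecture_hall_cone (Suc n)). l (Suc n) - l n = int t} \<and>
    card {l \<in> integer_points (lecture_hall_cone (Suc n)). l (Suc n) - l n = int t} = Suc t ^ n"
proof -
  let ?L = "\<lambda>n. integer_points (lecture_hall_cone n)"
  have "{l \<in> ?L (Suc n). l (Suc n) - l n = int t} = {l \<in> ?L (Suc n). l (Suc n) = l n + int t}"
    by auto
  moreover have "{l \<in> ?L n. 0 \<le> l n + int t \<and> l n * int (Suc n) \<le> (l n + int t) * int n}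
      = {l \<in> ?L n. l n \<le> int (n * t + 0)}"
    using integer_points_lecture_hall_cone_last_nonneg[of _ n] by (auto simp: algebra_simps)
  ultimately have "bij_betw (\<lambda>l. l(Suc n := 0)) {l \<in> ?L (Suc n). l (Suc n) - l n = int t}
      {l \<in> ?L n. l n \<le> int (n * t + 0)}"
    using bij_betw_forget_last[of n "\<lambda>x. x + int t"] by simp
  moreover note lecture_hall_cone_bounded_count[of 0 n t]
  ultimately show ?thesis
    by (simp add: bij_betw_finite bij_betw_same_card)
qed

section \<open>Descents under insertion of the largest letter\<close>

text \<open>If \<open>p\<close> permutes \<open>{1..<m}\<close>, then \<open>p \<circ> shift_up m j\<close> inserts the letter \<open>m\<close> at position \<open>j\<close>
  of the word of \<open>p\<close>.\<close>

definition shift_up :: "nat \<Rightarrow> nat \<Rightarrow> nat \<Rightarrow> nat" where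
  "shift_up m j i = (if i = j then m else if j < i \<and> i \<le> m then i - 1 else i)"

lemma shift_up_permutes:
  assumes "j \<in> {1..m}"
  shows "shift_up m j permutes {1..m}"
proof (rule bij_imp_permutes)
  show "bij_betw (shift_up m j) {1..m} {1..m}"
    by (rule bij_betw_byWitness[where f' = "\<lambda>i. if i = m then j else if j \<le> i then Suc i else i"])
      (use assms in \<open>auto simp: shift_up_def\<close>)
  show "shift_up m j x = x" if "x \<notin> {1..m}" for x
    using that assms by (auto simp: shift_up_def)
qed

text \<open>The position \<open>j\<close> is recovered as the place of the letter
  \<open>Suc m\<close> in \<open>q\<close>; undoing the shift then leaves a permutation fixing
  \<open>Suc m\<close>.\<close>

lemma bij_betw_insert_max:
  "bij_betw (\<lambda>(p, j). p \<circ> shift_up (Suc m) j)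
    ({p. p permutes {1..m}} \<times> {1..Suc m}) {q. q permutes {1..Suc m}}"
proof (rule bij_betw_byWitness
    [where f' = "\<lambda>q. (q \<circ> inv (shift_up (Suc m) (inv q (Suc m))), inv q (Suc m))"], goal_cases)
  case 1
  show ?case
  proof (intro ballI, elim SigmaE, goal_cases)
    case (1 x p j)
    then have p: "p permutes {1..m}" and j: "j \<in> {1..Suc m}" by auto
    let ?c = "shift_up (Suc m) j"
    have c: "?c permutes {1..Suc m}" using j by (rule shift_up_permutes)
    have p': "p permutes {1..Suc m}" using p by (rule permutes_subset) auto
    have "(p \<circ> ?c) j = Suc m"
      using permutes_not_in[OF p, of "Suc m"] by (simp add: shift_up_def)
    then have inv: "inv (p \<circ> ?c) (Suc m) = j"
      using permutes_inv_eq[OF permutes_compose[OF c p']] by simp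
    show ?case
      using permutes_inv_o(1)[OF c] by (simp add: 1 inv comp_assoc)
  qed
next
  case 2
  show ?case
  proof
    fix q assume q: "q \<in> {q. q permutes {1..Suc m}}"
    define j where "j = inv q (Suc m)"
    have "j \<in> {1..Suc m}"
      using q permutes_in_image[OF permutes_inv[of q "{1..Suc m}"]] by (simp add: j_def)
    then have "shift_up (Suc m) j permutes {1..Suc m}" by (rule shift_up_permutes)
    then have "q \<circ> inv (shift_up (Suc m) j) \<circ> shift_up (Suc m) j = q"
      by (simp add: comp_assoc permutes_inv_o)
    then show "(\<lambda>(p, j). p \<circ> shift_up (Suc m) j)
        (q \<circ> inv (shift_up (Suc m) (inv q (Suc m))), inv q (Suc m)) = q"
      by (simp add: j_def)
  qed
next
  case 3
  then show ?case
    by (auto intro!: permutes_compose shift_up_permutes elim: permutes_subset simp del: One_nat_def)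
next
  case 4
  show ?case
  proof (intro image_subsetI)
    fix q assume "q \<in> {q. q permutes {1..Suc m}}"
    then have q: "q permutes {1..Suc m}" by simp
    define j where "j = inv q (Suc m)"
    let ?c = "shift_up (Suc m) j"
    have j: "j \<in> {1..Suc m}"
      using permutes_in_image[OF permutes_inv[OF q]] by (simp add: j_def)
    then have c: "?c permutes {1..Suc m}" by (rule shift_up_permutes)
    have "?c j = Suc m" by (simp add: shift_up_def)
    then have "inv ?c (Suc m) = j" using permutes_inv_eq[OF c] by simp
    then have "(q \<circ> inv ?c) (Suc m) = Suc m"
      using permutes_inverses(1)[OF q] by (simp add: j_def)
    then have "q \<circ> inv ?c permutes {1..m}"
      by (intro permutes_superset[OF permutes_compose[OF permutes_inv[OF c] q]])
        (auto simp: le_Suc_eq)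
    then show "(q \<circ> inv (shift_up (Suc m) (inv q (Suc m))), inv q (Suc m))
        \<in> {p. p permutes {1..m}} \<times> {1..Suc m}"
      using j by (simp add: j_def)
  qed
qed

text \<open>Inserting the maximal letter at the end or inside a descent keeps the number of descents;
  any other position creates one.\<close>

lemma des_insert_max:
  assumes p: "p permutes {1..m}" and j: "j \<in> {1..Suc m}"
  defines "D \<equiv> {i \<in> {1..<m}. p i > p (Suc i)}"
  shows "des (Suc m) (p \<circ> shift_up (Suc m) j)
    = (if j \<in> insert (Suc m) (Suc ` D) then des m p else Suc (des m p))"
proof -
  have [simp]: "finite D" by (simp add: D_def)
  have des_D: "des m p = card D" by (simp only: des_def D_def)
  have p_le: "p i \<le> m" if "i \<le> m" for i
  proof (cases "i = 0")
    case True
    then show ?thesis using permutes_not_in[OF p, of i] by simp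
  next
    case False
    then show ?thesis using permutes_in_image[OF p, of i] that by simp
  qed
  have pS: "p (Suc m) = Suc m" using permutes_not_in[OF p, of "Suc m"] by simp
  let ?q = "p \<circ> shift_up (Suc m) j"
  \<comment> \<open>Descents left of the gap (\<open>A\<close>) stay, those right of it
    (\<open>B\<close>) move up by one, and the new letter starts a descent (\<open>J\<close>) unless
    it is last. A descent of \<open>p\<close> straddling the gap, \<open>Suc i = j\<close>, is
    destroyed.\<close>
  define A where "A = {i \<in> D. Suc i < j}"
  define B where "B = {i \<in> D. j \<le> i}"
  define J where "J = (if j \<le> m then {j} else {})"
  have mem: "i \<in> {1..<Suc m} \<and> ?q i > ?q (Suc i) \<longleftrightarrow> i \<in> A \<union> Suc ` B \<union> J" for i
  proof -
    consider "Suc i < j" | "Suc i = j" | "i = j" | k where "i = Suc k" "j \<le> k"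
      by (metis Suc_lessI less_imp_Suc_add linorder_neqE_nat less_Suc_eq_le add_Suc_right le_add1)
    then show ?thesis
    proof cases
      case 1
      then show ?thesis using j
        by (auto simp: shift_up_def A_def B_def J_def D_def)
    next
      case 2
      then show ?thesis using j p_le[of i]
        by (auto simp: shift_up_def A_def B_def J_def D_def pS)
    next
      case 3
      then show ?thesis using j p_le[of i]
        by (auto simp: shift_up_def A_def B_def J_def D_def pS less_Suc_eq_le)
    next
      case 4
      then show ?thesis using j
        by (auto simp: shift_up_def A_def B_def J_def D_def)
    qed
  qed
  then have "des (Suc m) ?q = card (A \<union> Suc ` B \<union> J)"
    unfolding des_def by (intro arg_cong[where f = card]) blast
  also have "\<dots> = card A + card (Suc ` B) + card J"
    by (subst card_Un_disjoint; (subst card_Un_disjoint)?) (auto simp: A_def B_def J_def)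
  also have "card (Suc ` B) = card B" by (simp add: card_image)
  finally have 1: "des (Suc m) ?q = card A + card B + card J" .
  have "D = A \<union> B \<union> {i \<in> D. Suc i = j}" by (auto simp: A_def B_def)
  then have "card D = card (A \<union> B \<union> {i \<in> D. Suc i = j})" by simp
  also have "\<dots> = card A + card B + card {i \<in> D. Suc i = j}"
    by (subst card_Un_disjoint; (subst card_Un_disjoint)?) (auto simp: A_def B_def)
  also have "{i \<in> D. Suc i = j} = (if j \<in> Suc ` D then {j - 1} else {})" by auto
  finally have 2: "des m p = card A + card B + (if j \<in> Suc ` D then 1 else 0)"
    by (simp add: des_D)
  have 3: "j \<notin> Suc ` D" if "j = Suc m" using that by (auto simp: D_def)
  have 4: "card J = (if j = Suc m then 0 else 1)" using j by (auto simp: J_def)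
  show ?thesis
    using 3 by (simp only: 1 2 4 insert_iff) simp
qed

text \<open>With \<open>d\<close> descents, \<open>d + 1\<close> positions preserve the number and
  the other \<open>m - d\<close> raise it. The difference is taken in the ring, so that the
  recurrence becomes pure ring algebra; this is faithful because \<open>d \<le> m\<close>.\<close>

lemma sum_insert_max:
  fixes f :: "nat \<Rightarrow> 'a::comm_ring_1"
  assumes "p permutes {1..m}"
  shows "(\<Sum>j=1..Suc m. f (des (Suc m) (p \<circ> shift_up (Suc m) j)))
    = of_nat (Suc (des m p)) * f (des m p) + (of_nat m - of_nat (des m p)) * f (Suc (des m p))"
proof -
  define D where "D = {i \<in> {1..<m}. p i > p (Suc i)}"
  define S where "S = insert (Suc m) (Suc ` D)"
  have D: "finite D" "card D = des m p" by (simp_all add: D_def des_def)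
  have "Suc m \<notin> Suc ` D" by (auto simp: D_def)
  with D have S: "finite S" "card S = Suc (des m p)" by (simp_all add: S_def card_image)
  have sub: "S \<subseteq> {1..Suc m}" by (auto simp: S_def D_def)
  have "(\<Sum>j=1..Suc m. f (des (Suc m) (p \<circ> shift_up (Suc m) j)))
      = (\<Sum>j=1..Suc m. if j \<in> S then f (des m p) else f (Suc (des m p)))"
    using des_insert_max[OF assms] by (intro sum.cong) (auto simp: S_def D_def)
  also have "\<dots> = (\<Sum>j\<in>S. f (des m p)) + (\<Sum>j\<in>{1..Suc m} - S. f (Suc (des m p)))"
    using sub by (subst sum.subset_diff[OF sub]) (auto intro!: arg_cong2[where f = "(+)"] sum.cong)
  also have "card ({1..Suc m} - S) = m - des m p"
    using S sub by (simp add: card_Diff_subset)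
  moreover have "des m p \<le> m"
    using card_mono[OF _ sub] S by simp
  ultimately show ?thesis
    using S by (simp add: of_nat_diff)
qed

section \<open>Recurrence and generating function of the Eulerian polynomials\<close>

lemma fps_of_eulerian_poly:
  "fps_of_poly (eulerian_poly m :: 'a::comm_ring_1 poly) = (\<Sum>p | p permutes {1..m}. fps_X ^ des m p)"
  by (simp add: eulerian_poly_def fps_of_poly_sum fps_of_poly_monom')

lemma fps_of_eulerian_poly_Suc:
  fixes m :: nat
  defines "F \<equiv> (\<lambda>m. fps_of_poly (eulerian_poly m :: 'a::comm_ring_1 poly))"
  shows "F (Suc m) = (1 + of_nat m * fps_X) * F m + fps_X * (1 - fps_X) * fps_deriv (F m)"
proof -
  let ?P = "{p. p permutes {1..m}}"
  \<comment> \<open>The operator \<open>X d/dX\<close> multiplies \<open>X^d\<close> by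
    \<open>d\<close>, so the weights depending on the number of descents become a derivative of the
    whole polynomial.\<close>
  have X_deriv: "fps_X * fps_deriv (fps_X ^ d) = of_nat d * (fps_X ^ d :: 'a fps)" for d
    unfolding fps_mult_fps_X_deriv_shift by (rule fps_ext) (simp add: fps_mult_of_nat_nth)
  have "F (Suc m) = (\<Sum>q | q permutes {1..Suc m}. fps_X ^ des (Suc m) q)"
    by (simp only: F_def fps_of_eulerian_poly)
  also have "\<dots> = (\<Sum>(p, j)\<in>?P \<times> {1..Suc m}. fps_X ^ des (Suc m) (p \<circ> shift_up (Suc m) j))"
    by (subst sum.reindex_bij_betw[OF bij_betw_insert_max, symmetric]) (simp add: case_prod_unfold)
  also have "\<dots> = (\<Sum>p\<in>?P. \<Sum>j=1..Suc m. fps_X ^ des (Suc m) (p \<circ> shift_up (Suc m) j))"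
    by (simp only: sum.cartesian_product)
  also have "\<dots> = (\<Sum>p\<in>?P. of_nat (Suc (des m p)) * fps_X ^ des m p
      + (of_nat m - of_nat (des m p)) * fps_X ^ Suc (des m p))"
    by (intro sum.cong refl sum_insert_max) simp
  also have "\<dots> = (\<Sum>p\<in>?P. (1 + of_nat m * fps_X) * fps_X ^ des m p
      + (1 - fps_X) * (fps_X * fps_deriv (fps_X ^ des m p)))"
    unfolding X_deriv by (intro sum.cong) (simp_all add: algebra_simps)
  also have "\<dots> = (1 + of_nat m * fps_X) * F m + fps_X * (1 - fps_X) * fps_deriv (F m)"
    by (simp add: F_def fps_of_eulerian_poly sum.distrib sum_distrib_left fps_deriv_sum mult_ac)
  finally show ?thesis .
qed

text \<open>Both sides satisfy the same recurrence in \<open>m\<close>: the series with coefficients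
  \<open>(t + 1)^(m + 1)\<close> is the derivative of \<open>X\<close> times the one for
  \<open>m\<close>. The form without division makes sense over any commutative ring.\<close>

lemma eulerian_poly_generating_function:
  "Abs_fps (\<lambda>t. of_nat (Suc t) ^ m) * (1 - fps_X) ^ Suc m
    = fps_of_poly (eulerian_poly m :: 'a::comm_ring_1 poly)"
proof (induction m)
  case 0
  have "Abs_fps (\<lambda>t. 1) * (1 - fps_X) = (1 :: 'a fps)"
    by (rule fps_ext) (simp add: right_diff_distrib)
  then show ?case
    by (simp add: fps_of_eulerian_poly des_def)
next
  case (Suc m)
  define G where "G = Abs_fps (\<lambda>t. of_nat (Suc t) ^ m :: 'a)"
  define P where "P = (1 - fps_X :: 'a fps)"
  define A where "A = fps_of_poly (eulerian_poly m :: 'a poly)"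
  have A: "A = G * P ^ Suc m" using Suc.IH by (simp add: A_def G_def P_def)
  have "fps_deriv P = -1" by (simp add: P_def)
  then have dA: "fps_deriv A = fps_deriv G * P ^ Suc m - of_nat (Suc m) * G * P ^ m"
    unfolding A fps_deriv_mult fps_deriv_power' diff_Suc_1 by (simp add: algebra_simps)
  have "Abs_fps (\<lambda>t. of_nat (Suc t) ^ Suc m) = fps_deriv (fps_X * G)"
    by (rule fps_ext) (auto simp: G_def algebra_simps)
  also have "\<dots> = G + fps_X * fps_deriv G" by simp
  finally have dG: "Abs_fps (\<lambda>t. of_nat (Suc t) ^ Suc m) = G + fps_X * fps_deriv G" .
  \<comment> \<open>To be used with \<open>g = G\<close>, \<open>d = G'\<close>,
    \<open>c = m\<close> and \<open>q = P^m\<close>; abstracting the power leaves a polynomial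
    identity.\<close>
  have ring: "(g + x * d) * ((1 - x) * ((1 - x) * q)) = (1 + c * x) * (g * ((1 - x) * q))
      + x * (1 - x) * (d * ((1 - x) * q) - (1 + c) * g * q)" for c d g q x :: "'a fps"
    by (simp add: algebra_simps)
  have "Abs_fps (\<lambda>t. of_nat (Suc t) ^ Suc m) * P ^ Suc (Suc m)
      = (1 + of_nat m * fps_X) * A + fps_X * P * fps_deriv A"
    unfolding dG dA unfolding A power_Suc of_nat_Suc unfolding P_def by (rule ring)
  then show ?case
    by (simp only: fps_of_eulerian_poly_Suc A_def P_def)
qed

section \<open>Convergence of the formal sums\<close>

text \<open>Convergence is coefficientwise, and the coefficient at \<open>t\<close> is constant once
  the finite partial sum contains the whole fiber over \<open>t\<close>.\<close>

lemma has_sum_fps_X_power: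
  fixes g :: "'i \<Rightarrow> nat"
  assumes "\<And>t. finite {x \<in> A. g x = t}"
  shows "((\<lambda>x. fps_X ^ g x) has_sum Abs_fps (\<lambda>t. of_nat (card {x \<in> A. g x = t}) :: 'a::comm_ring_1)) A"
  unfolding has_sum_def
proof (rule tendsto_fpsI)
  fix t
  let ?B = "{x \<in> A. g x = t}"
  have "fps_nth (\<Sum>x\<in>F. fps_X ^ g x :: 'a fps) t = of_nat (card ?B)"
    if "finite F" "?B \<subseteq> F" "F \<subseteq> A" for F
  proof -
    have "fps_nth (\<Sum>x\<in>F. fps_X ^ g x :: 'a fps) t = (\<Sum>x\<in>F. if g x = t then 1 else 0)"
      by (simp add: fps_sum_nth eq_commute)
    also have "\<dots> = of_nat (card {x \<in> F. g x = t})"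
      using that by (simp add: sum.If_cases Int_def)
    also have "{x \<in> F. g x = t} = ?B" using that by auto
    finally show ?thesis .
  qed
  then show "\<forall>\<^sub>F F in finite_subsets_at_top A. fps_nth (\<Sum>x\<in>F. fps_X ^ g x) t
      = fps_nth (Abs_fps (\<lambda>t. of_nat (card {x \<in> A. g x = t}) :: 'a)) t"
    unfolding eventually_finite_subsets_at_top using assms[of t]
    by (intro exI[of _ ?B]) auto
qed

lemma dist_fps_to_fls: "dist (fps_to_fls f) (fps_to_fls g) = dist f g"
  by (simp add: dist_fls_def dist_fps_def fls_subdegree_fls_to_fps flip: fps_to_fls_minus)

text \<open>The embedding is additive and, since it preserves subdegrees, isometric; hence it is
  continuous and commutes with infinite sums.\<close>

lemma has_sum_fps_to_fls:
  fixes f :: "'i \<Rightarrow> 'a::ab_group_add fps"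
  assumes "(f has_sum S) A"
  shows "((\<lambda>x. fps_to_fls (f x)) has_sum fps_to_fls S) A"
proof -
  have "(fps_to_fls \<circ> f has_sum fps_to_fls S) A"
  proof (rule has_sum_comm_additive[OF _ _ assms])
    show "additive (fps_to_fls :: 'a fps \<Rightarrow> _)" by (simp add: additive_def)
    show "fps_to_fls \<midarrow>S\<rightarrow> fps_to_fls S"
      by (auto simp: LIM_def dist_fps_to_fls)
  qed
  then show ?thesis by (simp add: o_def)
qed

lemma laurent_monomial_last_diff:
  fixes l :: "nat \<Rightarrow> int" and z :: "'a::field"
  assumes "n \<ge> 1" "z \<noteq> 0" "l 0 = 0"
  shows "laurent_monomial n (\<lambda>i. if i = n then z else if i = n - 1 then inverse z else 1) l
    = z powi (l n - l (n - 1))"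
proof -
  let ?w = "\<lambda>i. if i = n then z else if i = n - 1 then inverse z else 1"
  have "(\<Prod>i=1..n. ?w i powi l i) = (\<Prod>i\<in>{n - 1, n}. ?w i powi l i)"
  proof (rule prod.mono_neutral_cong)
    \<comment> \<open>Only \<open>n = 1\<close> leaves an index outside the range, namely
      \<open>0\<close>; its factor is \<open>1\<close> because \<open>l 0 = 0\<close>.\<close>
    show "?w i powi l i = 1" if "i \<in> {n - 1, n} - {1..n}" for i
      using that assms by (cases "i = 0") auto
  qed auto
  also have "\<dots> = inverse z powi l (n - 1) * z powi l n"
    using assms(1) by (simp add: less_imp_neq)
  also have "\<dots> = z powi (l n - l (n - 1))"
    using assms by (simp add: power_int_diff power_int_inverse field_simps)
  finally show ?thesis by (simp add: laurent_monomial_def)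
qed

theorem theorem2:
  fixes n :: nat
  assumes "n \<ge> 1"
  defines "L \<equiv> integer_points (lecture_hall_cone n)"
    and "w \<equiv> (\<lambda>i. if i = n then fls_X else if i = n - 1 then inverse fls_X else 1)
                 :: nat \<Rightarrow> 'a::field_char_0 fls"
  shows "((\<lambda>l. fps_X ^ nat (l n - l (n - 1))) has_sum
            (fps_of_poly (eulerian_poly (n - 1)) / (1 - fps_X) ^ n :: 'a fps)) L \<and>
         laurent_monomial n w summable_on L \<and>
         integer_point_transform n (lecture_hall_cone n) w
           = fps_to_fls (fps_of_poly (eulerian_poly (n - 1))) / (1 - fls_X) ^ n"
proof -
  let ?g = "\<lambda>l :: nat \<Rightarrow> int. nat (l n - l (n - 1))"
  let ?A = "fps_of_poly (eulerian_poly (n - 1)) :: 'a fps"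
  obtain m where n: "n = Suc m" using \<open>n \<ge> 1\<close> by (cases n) auto
  have fiber: "{l \<in> L. ?g l = t} = {l \<in> L. l n - l (n - 1) = int t}" for t
    using integer_points_last_diff_nonneg[OF _ \<open>n \<ge> 1\<close>] by (auto simp: L_def)
  have count: "finite {l \<in> L. ?g l = t} \<and> card {l \<in> L. ?g l = t} = Suc t ^ (n - 1)" for t
    unfolding fiber using lecture_hall_cone_last_diff_count[of m t] by (simp add: L_def n)
  have "(1 - fps_X :: 'a fps) ^ n \<noteq> 0"
    by (intro power_not_zero) (simp add: fps_eq_iff exI[of _ "0::nat"])
  moreover have "Abs_fps (\<lambda>t. of_nat (Suc t) ^ (n - 1)) * (1 - fps_X) ^ n = ?A"
    using eulerian_poly_generating_function[of "n - 1", where 'a = 'a] by (simp add: n)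
  ultimately have gf: "Abs_fps (\<lambda>t. of_nat (Suc t) ^ (n - 1)) = ?A / (1 - fps_X) ^ n"
    by (metis nonzero_mult_div_cancel_right)
  have "((\<lambda>l. fps_X ^ ?g l) has_sum Abs_fps (\<lambda>t. of_nat (card {l \<in> L. ?g l = t}) :: 'a)) L"
    using count by (intro has_sum_fps_X_power) blast
  then have fps: "((\<lambda>l. fps_X ^ ?g l) has_sum (?A / (1 - fps_X) ^ n)) L"
    by (simp only: count of_nat_power gf)
  have "fps_to_fls (fps_X ^ ?g l) = laurent_monomial n w l" if "l \<in> L" for l
  proof -
    have "l n - l (n - 1) \<ge> 0"
      using that integer_points_last_diff_nonneg[OF _ \<open>n \<ge> 1\<close>] by (simp add: L_def)
    moreover have "laurent_monomial n w l = fls_X powi (l n - l (n - 1))"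
      unfolding w_def using that \<open>n \<ge> 1\<close>
      by (intro laurent_monomial_last_diff) (auto simp: L_def integer_points_lecture_hall_cone_outside)
    ultimately show ?thesis
      by (simp add: power_int_def fps_to_fls_power)
  qed
  then have fls: "(laurent_monomial n w has_sum fps_to_fls (?A / (1 - fps_X) ^ n)) L"
    using has_sum_fps_to_fls[OF fps] by (simp cong: has_sum_cong)
  \<comment> \<open>The denominator has subdegree \<open>0\<close>, so division of power series
    agrees with division in the Laurent field.\<close>
  have "fps_to_fls (?A / (1 - fps_X) ^ n) = fps_to_fls ?A / (1 - fls_X) ^ n"
    by (subst fls_divide_fps_to_fls[symmetric]) (simp_all add: fps_to_fls_power subdegree_power)
  with fps fls show ?thesis
    by (auto simp: integer_point_transform_def L_def summable_on_def dest: infsumI)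
qed

end
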